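(* Let $X$ be a $k$-step groupspace for some $k\ge 2$. Then all fibers of $X$ are isomorphic (as groupspaces).
   Context: Notation: $[n]=\{1,\dots,n\}$; $\{0,1\}^0$ is a one point set; $1^n$ is the all-one vector; $\{0,1\}^n_*=\{0,1\}^n\setminus\{1^n\}$. $\mathcal{G}$-morphisms: a map $\phi:\{0,1\}^n\to\{0,1\}^m$ is a morphism in $\mathcal{G}$ if for every $i\in[m]$ the function $v\mapsto\phi(v)_i$ is either constant (then put $\gamma_\phi(i)=0$) or equal to $v\mapsto v_j$ or $v\mapsto 1-v_j$ for some $j\in[n]$ (then put $\gamma_\phi(i)=j$), and for all $1\le i<j\le m$ either $\gamma_\phi(j)=0$ or $\gamma_\phi(i)\le\gamma_\phi(j)$. For $i\in[n]$, $j\in\{0,1\}$ the face embedding $e^n_{i,j}:\{0,1\}^{n-1}\to\{0,1\}^n$ is $e^n_{i,j}(x_1,\dots,x_{n-1})=(x_1,\dots,x_{i-1},j,x_i,\dots,x_{n-1})$. A cube-structure is a set $X$ with subsets $C^n(X)\subseteq X^{\{0,1\}^n}$ for $n=0,1,2,\dots$. It is a groupspace if: (presheaf) $\psi\in C^m(X)$ and $\phi:\{0,1\}^n\to\{0,1\}^m$ a morphism in $\mathcal{G}$ imply $\psi\circ\phi\in C^n(X)$; (ergodicity) $C^1(X)=X^{\{0,1\}}$; (completion) for every $n\ge 0$, if $f:\{0,1\}^n_*\to X$ satisfies $f\circ e^n_{i,0}\in C^{n-1}(X)$ for all $i\in[n]$, then some $\phi\in C^n(X)$ restricts to $f$ on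 $\{0,1\}^n_*$. A groupspace is $k$-step if for $n=k+1$ the completion $\phi$ is always uniquely determined by $f$. Two cube-structures are isomorphic if there is a bijection $m$ between them such that, for all $n$, $c$ is an $n$-cube of the first if and only if $m\circ c$ is an $n$-cube of the second. For $x,y\in X$, $x\sim_i y$ means there are $c_1,c_2\in C^{i+1}(X)$ with $c_1(1^{i+1})=x$, $c_2(1^{i+1})=y$ and $c_1=c_2$ on $\{0,1\}^{i+1}_*$; this is an equivalence relation. A fiber of a $k$-step groupspace $X$ is an equivalence class $F$ of $\sim_{k-1}$ equipped with the cubes $C^n(F)=\{c\in C^n(X): c(v)\in F\ \forall v\in\{0,1\}^n\}$ (this is a groupspace). *)

theory Defs
  imports Main "HOL-Library.FuncSet"
begin

text \<open>The vertices of the discrete cube of dimension n are the Boolean lists of length n, with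
  False for 0 and True for 1. Coordinates are numbered from 1 to n, so that coordinate i of a
  vertex v is \<open>v ! (i - 1)\<close>. Maps defined on a set of vertices are extensional functions
  (undefined elsewhere), so that equality of functions is equality of maps.\<close>

definition vertices :: "nat \<Rightarrow> bool list set" where
  "vertices n = {v. length v = n}"

definition all_ones :: "nat \<Rightarrow> bool list" where
  "all_ones n = replicate n True"

definition vertices_star :: "nat \<Rightarrow> bool list set" where
  "vertices_star n = vertices n - {all_ones n}"

definition coord_const :: "nat \<Rightarrow> (bool list \<Rightarrow> bool list) \<Rightarrow> nat \<Rightarrow> bool" where
  "coord_const n \<phi> i \<longleftrightarrow> (\<exists>b. \<forall>v\<in>vertices n. \<phi> v ! (i - 1) = b)"

definition coord_from :: "nat \<Rightarrow> (bool list \<Rightarrow> bool list) \<Rightarrow> nat \<Rightarrow> nat \<Rightarrow> bool" where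
  "coord_from n \<phi> i j \<longleftrightarrow>
     (\<forall>v\<in>vertices n. \<phi> v ! (i - 1) = v ! (j - 1)) \<or>
     (\<forall>v\<in>vertices n. \<phi> v ! (i - 1) = (\<not> v ! (j - 1)))"

definition gam :: "nat \<Rightarrow> (bool list \<Rightarrow> bool list) \<Rightarrow> nat \<Rightarrow> nat" where
  "gam n \<phi> i = (if coord_const n \<phi> i then 0 else (THE j. j \<in> {1..n} \<and> coord_from n \<phi> i j))"

text \<open>The definite description in \<^const>\<open>gam\<close> is well defined, and the two cases exclude
  each other.\<close>

lemma coord_from_eq_iff:
  assumes "coord_from n \<phi> i j" "length v = n" "length w = n"
  shows "\<phi> v ! (i - 1) = \<phi> w ! (i - 1) \<longleftrightarrow> v ! (j - 1) = w ! (j - 1)"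
proof -
  have "v \<in> vertices n" "w \<in> vertices n" using assms by (simp_all add: vertices_def)
  then show ?thesis using assms(1) unfolding coord_from_def by (elim disjE) simp_all
qed

lemma coord_from_imp_not_const:
  assumes "j \<in> {1..n}" "coord_from n \<phi> i j"
  shows "\<not> coord_const n \<phi> i"
proof
  assume "coord_const n \<phi> i"
  then have "\<phi> (replicate n True) ! (i - 1) = \<phi> (replicate n False) ! (i - 1)"
    by (auto simp: coord_const_def vertices_def)
  moreover have "j - 1 < n" using assms(1) by auto
  ultimately show False
    using coord_from_eq_iff[OF assms(2), of "replicate n True" "replicate n False"] by simp
qed

lemma gam_eq:
  assumes j: "j \<in> {1..n}" "coord_from n \<phi> i j"
  shows "gam n \<phi> i = j"
proof -
  have uniq: "j' = j" if j': "j' \<in> {1..n}" "coord_from n \<phi> i j'" for j'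
  proof (rule ccontr)
    assume "j' \<noteq> j"
    define w where "w = (replicate n False)[j - 1 := True]"
    define z where "z = replicate n False"
    have len: "length w = n" "length z = n" by (simp_all add: w_def z_def)
    have lt: "j - 1 < n" "j' - 1 < n" "j - 1 \<noteq> j' - 1"
      using j(1) j'(1) \<open>j' \<noteq> j\<close> by auto
    have "w ! (j - 1)" "\<not> z ! (j - 1)" "\<not> w ! (j' - 1)" "\<not> z ! (j' - 1)"
      using lt by (simp_all add: w_def z_def)
    then show False
      using coord_from_eq_iff[OF j(2) len] coord_from_eq_iff[OF j'(2) len] by metis
  qed
  have "(THE j. j \<in> {1..n} \<and> coord_from n \<phi> i j) = j"
    by (rule the_equality) (use j in blast, blast intro: uniq)
  then show ?thesis
    using coord_from_imp_not_const[OF j] by (simp add: gam_def)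
qed

definition G_morphism :: "nat \<Rightarrow> nat \<Rightarrow> (bool list \<Rightarrow> bool list) \<Rightarrow> bool" where
  "G_morphism n m \<phi> \<longleftrightarrow>
     \<phi> \<in> vertices n \<rightarrow> vertices m \<and>
     (\<forall>i\<in>{1..m}. coord_const n \<phi> i \<or> (\<exists>j\<in>{1..n}. coord_from n \<phi> i j)) \<and>
     (\<forall>i j. 1 \<le> i \<and> i < j \<and> j \<le> m \<longrightarrow> gam n \<phi> j = 0 \<or> gam n \<phi> i \<le> gam n \<phi> j)"

text \<open>Insertion of the value b as i-th coordinate: the face embedding from dimension n - 1 to
  dimension n, for i in 1, ..., n.\<close>

definition face_emb :: "nat \<Rightarrow> bool \<Rightarrow> bool list \<Rightarrow> bool list" where
  "face_emb i b x = take (i - 1) x @ b # drop (i - 1) x"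

record 'a cube_structure =
  points :: "'a set"
  cubes :: "nat \<Rightarrow> (bool list \<Rightarrow> 'a) set"

definition is_cube_structure :: "'a cube_structure \<Rightarrow> bool" where
  "is_cube_structure A \<longleftrightarrow> (\<forall>n. cubes A n \<subseteq> vertices n \<rightarrow>\<^sub>E points A)"

definition presheaf :: "'a cube_structure \<Rightarrow> bool" where
  "presheaf A \<longleftrightarrow>
     (\<forall>n m \<psi> \<phi>. \<psi> \<in> cubes A m \<and> G_morphism n m \<phi> \<longrightarrow> compose (vertices n) \<psi> \<phi> \<in> cubes A n)"

definition ergodic :: "'a cube_structure \<Rightarrow> bool" where
  "ergodic A \<longleftrightarrow> cubes A 1 = (vertices 1 \<rightarrow>\<^sub>E points A)"

definition corner :: "'a cube_structure \<Rightarrow> nat \<Rightarrow> (bool list \<Rightarrow> 'a) \<Rightarrow> bool" where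
  "corner A n f \<longleftrightarrow>
     f \<in> vertices_star n \<rightarrow>\<^sub>E points A \<and>
     (\<forall>i\<in>{1..n}. compose (vertices (n - 1)) f (face_emb i False) \<in> cubes A (n - 1))"

definition completes :: "'a cube_structure \<Rightarrow> nat \<Rightarrow> (bool list \<Rightarrow> 'a) \<Rightarrow> (bool list \<Rightarrow> 'a) \<Rightarrow> bool" where
  "completes A n f \<phi> \<longleftrightarrow> \<phi> \<in> cubes A n \<and> restrict \<phi> (vertices_star n) = f"

definition completion :: "'a cube_structure \<Rightarrow> bool" where
  "completion A \<longleftrightarrow> (\<forall>n f. corner A n f \<longrightarrow> (\<exists>\<phi>. completes A n f \<phi>))"

definition groupspace :: "'a cube_structure \<Rightarrow> bool" where
  "groupspace A \<longleftrightarrow> is_cube_structure A \<and> presheaf A \<and> ergodic A \<and> completion A"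

definition step_groupspace :: "nat \<Rightarrow> 'a cube_structure \<Rightarrow> bool" where
  "step_groupspace k A \<longleftrightarrow>
     groupspace A \<and> (\<forall>f. corner A (k + 1) f \<longrightarrow> (\<exists>!\<phi>. completes A (k + 1) f \<phi>))"

definition cube_isomorphic :: "'a cube_structure \<Rightarrow> 'b cube_structure \<Rightarrow> bool" where
  "cube_isomorphic A B \<longleftrightarrow>
     (\<exists>m. bij_betw m (points A) (points B) \<and>
       (\<forall>n. \<forall>c \<in> vertices n \<rightarrow>\<^sub>E points A.
          c \<in> cubes A n \<longleftrightarrow> compose (vertices n) m c \<in> cubes B n))"

definition sim_rel :: "'a cube_structure \<Rightarrow> nat \<Rightarrow> ('a \<times> 'a) set" where
  "sim_rel A i =
     {(x, y) \<in> points A \<times> points A. \<exists>c1 \<in> cubes A (i + 1). \<exists>c2 \<in> cubes A (i + 1).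
        c1 (all_ones (i + 1)) = x \<and> c2 (all_ones (i + 1)) = y \<and>
        (\<forall>v\<in>vertices_star (i + 1). c1 v = c2 v)}"

definition sub_structure :: "'a cube_structure \<Rightarrow> 'a set \<Rightarrow> 'a cube_structure" where
  "sub_structure A F =
     \<lparr>points = F, cubes = (\<lambda>n. {c \<in> cubes A n. \<forall>v\<in>vertices n. c v \<in> F})\<rparr>"

definition fibers :: "nat \<Rightarrow> 'a cube_structure \<Rightarrow> 'a cube_structure set" where
  "fibers k A = sub_structure A ` (points A // sim_rel A (k - 1))"

end

theory Submission
  imports Defs
begin

text \<open>Fix base points p and q of two fibers. A point x of the fiber of p is sent to the point y
  obtained by unique completion of the (k+1)-dimensional corner which is p on the lower face and q
  on the upper face (in the last direction), except for the value x at the last vertex of the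
  lower face. To see that this map m preserves cubes, one shows that the (n+1)-dimensional map
  with lower face c and upper face m c is a cube whenever c is an n-cube of the fiber. For n = k
  one replaces the edges of the constant cube (p, q) by the edges (c v, m (c v)) one vertex at a
  time. Each replacement is a gluing of cubes in a grid, which is possible in one direction at a
  time although cubes need not be invariant under permutation of coordinates. The case n < k follows
  by degeneracy and the case n > k by induction and uniqueness of completion.\<close>

section \<open>Morphisms of G, and insertion and deletion of coordinates\<close>

text \<open>A function on bool is constant, the identity or negation, so reading each coordinate
  through \<open>h i\<close> from one source \<open>src i\<close> gives an admissible coordinate.
  Constant coordinates have \<open>gam\<close> equal to 0; their sources are free to be chosen so
  that \<open>src\<close> is monotone.\<close>

lemma G_morphismI:
  assumes len: "\<And>v. length v = n \<Longrightarrow> length (\<phi> v) = m"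
    and src: "\<And>i v. i < m \<Longrightarrow> length v = n \<Longrightarrow> \<phi> v ! i = h i (v ! src i)"
    and bound: "\<And>i. i < m \<Longrightarrow> src i < n \<or> (\<exists>b. h i = (\<lambda>_. b))"
    and "mono src"
  shows "G_morphism n m \<phi>"
proof -
  have cases: "coord_const n \<phi> i \<or> Suc (src (i - 1)) \<in> {1..n} \<and> coord_from n \<phi> i (Suc (src (i - 1)))"
    if "i \<in> {1..m}" for i
  proof -
    have i: "i - 1 < m" using that by auto
    have eq: "\<phi> v ! (i - 1) = h (i - 1) (v ! src (i - 1))" if "v \<in> vertices n" for v
      using src[OF i] that by (simp add: vertices_def)
    consider b where "h (i - 1) = (\<lambda>_. b)" | "h (i - 1) = (\<lambda>b. b)" | "h (i - 1) = Not"
      by (cases "h (i - 1) True"; cases "h (i - 1) False") (auto simp: fun_eq_iff all_bool_eq)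
    then show ?thesis
    proof cases
      case 1
      then show ?thesis using eq by (auto simp: coord_const_def)
    next
      case 2
      then have "src (i - 1) < n" using bound[OF i] by metis
      then show ?thesis using eq 2 by (auto simp: coord_from_def)
    next
      case 3
      then have "src (i - 1) < n" using bound[OF i] by metis
      then show ?thesis using eq 3 by (auto simp: coord_from_def)
    qed
  qed
  have gam: "gam n \<phi> i = (if coord_const n \<phi> i then 0 else Suc (src (i - 1)))" if "i \<in> {1..m}" for i
    using cases[OF that] gam_eq[of "Suc (src (i - 1))" n \<phi> i] by (auto simp: gam_def)
  have "gam n \<phi> j = 0 \<or> gam n \<phi> i \<le> gam n \<phi> j" if "1 \<le> i" "i < j" "j \<le> m" for i j
    using gam[of i] gam[of j] that monoD[OF \<open>mono src\<close>, of "i - 1" "j - 1"] by auto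
  moreover have "\<phi> \<in> vertices n \<rightarrow> vertices m" using len by (auto simp: vertices_def)
  ultimately show ?thesis using cases unfolding G_morphism_def by blast
qed

text \<open>The increasing enumeration of the indices different from i, describing where
  \<open>del i\<close> reads its entries. Coordinates are counted from 0 from here on, whereas
  \<open>face_emb\<close> counts from 1; hence faces appear as
  \<open>face_emb (Suc i)\<close>.\<close>

definition skip :: "nat \<Rightarrow> nat \<Rightarrow> nat" where
  "skip i j = (if j < i then j else Suc j)"

definition del :: "nat \<Rightarrow> bool list \<Rightarrow> bool list" where
  "del i v = take i v @ drop (Suc i) v"

lemma length_face_emb: "i \<le> length x \<Longrightarrow> length (face_emb (Suc i) b x) = Suc (length x)"
  by (simp add: face_emb_def)

lemma nth_face_emb:
  assumes "i \<le> length x"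
  shows "face_emb (Suc i) b x ! j = (if j < i then x ! j else if j = i then b else x ! (j - 1))"
  using assms by (auto simp: face_emb_def nth_append nth_Cons' not_less)

lemma length_del: "i < length v \<Longrightarrow> length (del i v) = length v - 1"
  by (simp add: del_def)

lemma nth_del: "i < length v \<Longrightarrow> j < length v - 1 \<Longrightarrow> del i v ! j = v ! skip i j"
  by (auto simp: del_def skip_def nth_append)

lemma del_face_emb: "i \<le> length x \<Longrightarrow> del i (face_emb (Suc i) b x) = x"
  by (simp add: del_def face_emb_def)

lemma face_emb_del:
  assumes "i < length v" "v ! i = b"
  shows "face_emb (Suc i) b (del i v) = v"
  using id_take_nth_drop[of i v] assms by (simp add: del_def face_emb_def)

text \<open>The cubical identity, needed to compare a face of one face with a face of
  another.\<close>

lemma face_emb_commute: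
  assumes "j \<le> i" "i \<le> length y"
  shows "face_emb (Suc (Suc i)) b (face_emb (Suc j) b' y) = face_emb (Suc j) b' (face_emb (Suc i) b y)"
proof (rule nth_equalityI)
  fix l
  assume "l < length (face_emb (Suc (Suc i)) b (face_emb (Suc j) b' y))"
  show "face_emb (Suc (Suc i)) b (face_emb (Suc j) b' y) ! l
      = face_emb (Suc j) b' (face_emb (Suc i) b y) ! l"
    using assms by (cases l) (auto simp: length_face_emb nth_face_emb)
qed (use assms in \<open>simp add: length_face_emb\<close>)

lemma vertex_ones_iff: "length v = n \<Longrightarrow> v = all_ones n \<longleftrightarrow> (\<forall>i<n. v ! i)"
  unfolding all_ones_def by (subst list_eq_iff_nth_eq) simp

section \<open>Pairs, spikes and grid steps\<close>

definition pair :: "nat \<Rightarrow> (bool list \<Rightarrow> 'a) \<Rightarrow> (bool list \<Rightarrow> 'a) \<Rightarrow> bool list \<Rightarrow> 'a" where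
  "pair k c d v = (if v ! k then d (take k v) else c (take k v))"

lemma pair_eq: "take k v = w \<Longrightarrow> v ! k = b \<Longrightarrow> pair k c d v = (if b then d w else c w)"
  by (simp add: pair_def)

lemma pair_face_last: "length x = k \<Longrightarrow> pair k c d (face_emb (Suc k) b x) = (if b then d x else c x)"
  by (simp add: pair_def face_emb_def nth_append)

lemma pair_face:
  assumes "length x = Suc k" "i \<le> k"
  shows "pair (Suc k) c d (face_emb (Suc i) b x) =
    pair k (\<lambda>x. c (face_emb (Suc i) b x)) (\<lambda>x. d (face_emb (Suc i) b x)) x"
proof -
  have "take (Suc k) (face_emb (Suc i) b x) = face_emb (Suc i) b (take k x)"
    using assms by (intro nth_equalityI) (auto simp: length_face_emb nth_face_emb)
  then show ?thesis using assms by (simp add: pair_def nth_face_emb)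
qed

text \<open>That a spike is a k-cube will encode that x lies in the class of p under
  \<open>sim_rel X (k - 1)\<close>; see \<open>sim_rel_Image\<close>.\<close>

definition spike :: "nat \<Rightarrow> 'a \<Rightarrow> 'a \<Rightarrow> bool list \<Rightarrow> 'a" where
  "spike k p x v = (if v = all_ones k then x else p)"

text \<open>The unit steps in direction 0 to 1 and 1 to 2, and the double step, in a grid
  with coordinates in 0, 1, 2.\<close>

definition lo :: "bool \<Rightarrow> nat" where "lo b = of_bool b"
definition hi :: "bool \<Rightarrow> nat" where "hi b = Suc (of_bool b)"
definition outer :: "bool \<Rightarrow> nat" where "outer b = 2 * of_bool b"

section \<open>Cubes of a groupspace and their images under basic morphisms\<close>

locale groupspace_loc =
  fixes X :: "'a cube_structure"
  assumes groupspace: "groupspace X"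
begin

text \<open>Only the values on the vertices count, so cubes can be written as plain lambda terms and
  exchanged by \<open>cube_cong\<close>.\<close>

definition cube :: "nat \<Rightarrow> (bool list \<Rightarrow> 'a) \<Rightarrow> bool" where
  "cube n f \<longleftrightarrow> restrict f (vertices n) \<in> cubes X n"

lemma cube_cong: "(\<And>v. length v = n \<Longrightarrow> f v = g v) \<Longrightarrow> cube n f = cube n g"
proof -
  assume "\<And>v. length v = n \<Longrightarrow> f v = g v"
  then have "restrict f (vertices n) = restrict g (vertices n)"
    by (intro restrict_ext) (simp add: vertices_def)
  then show ?thesis by (simp add: cube_def)
qed

lemma cube_cubes: "c \<in> cubes X n \<Longrightarrow> cube n c"
proof -
  assume c: "c \<in> cubes X n"
  then have "c \<in> vertices n \<rightarrow>\<^sub>E points X"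
    using groupspace unfolding groupspace_def is_cube_structure_def by blast
  then have "restrict c (vertices n) = c"
    using PiE_restrict by metis
  with c show ?thesis by (simp add: cube_def)
qed

lemma cube_points: "cube n f \<Longrightarrow> length v = n \<Longrightarrow> f v \<in> points X"
proof -
  assume c: "cube n f" and v: "length v = n"
  then have "restrict f (vertices n) \<in> vertices n \<rightarrow>\<^sub>E points X"
    using groupspace unfolding groupspace_def is_cube_structure_def cube_def by blast
  then have "restrict f (vertices n) v \<in> points X"
    by (rule PiE_mem) (simp add: v vertices_def)
  then show ?thesis by (simp add: v vertices_def)
qed

lemma cube_morphism:
  assumes "cube m f" "G_morphism n m \<phi>"
  shows "cube n (\<lambda>v. f (\<phi> v))"
proof -
  have "compose (vertices n) (restrict f (vertices m)) \<phi> \<in> cubes X n"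
    using assms groupspace unfolding groupspace_def presheaf_def cube_def by blast
  moreover have "compose (vertices n) (restrict f (vertices m)) \<phi> = (\<lambda>v\<in>vertices n. f (\<phi> v))"
    using assms(2) unfolding G_morphism_def compose_def by (intro restrict_ext) auto
  ultimately show ?thesis by (simp add: cube_def)
qed

lemma cube_face:
  assumes "cube (Suc n) f" "i \<le> n"
  shows "cube n (\<lambda>x. f (face_emb (Suc i) b x))"
  using assms(1)
proof (rule cube_morphism)
  show "G_morphism n (Suc n) (face_emb (Suc i) b)"
  \<comment> \<open>The inserted coordinate is constant, so its source may be any value keeping the
    map monotone, even the out-of-range value n when i = n.\<close>
  proof (rule G_morphismI[where src = "\<lambda>j. if j \<le> i then j else j - 1"
        and h = "\<lambda>j c. if j = i then b else c"])
    show "mono (\<lambda>j. if j \<le> i then j else j - 1)" by (auto simp: mono_def)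
    show "(if j \<le> i then j else j - 1) < n \<or> (\<exists>b'. (\<lambda>c. if j = i then b else c) = (\<lambda>_. b'))"
      if "j < Suc n" for j
      using that assms(2) by (cases "j = i") auto
  qed (use assms(2) in \<open>auto simp: length_face_emb nth_face_emb\<close>)
qed

text \<open>Each coordinate may independently be kept, negated or frozen; this supplies the
  reflected and the degenerate blocks of the grids below.\<close>

lemma cube_coordinatewise:
  assumes "cube n f"
  shows "cube n (\<lambda>v. f (map (\<lambda>a. h a (v ! a)) [0..<n]))"
  using assms
proof (rule cube_morphism)
  show "G_morphism n n (\<lambda>v. map (\<lambda>a. h a (v ! a)) [0..<n])"
    by (rule G_morphismI[where src = "\<lambda>j. j" and h = h]) (auto simp: mono_def)
qed

text \<open>Coordinates i and \<open>Suc i\<close> of the image are the negation of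
  \<open>v ! i\<close> and \<open>v ! i\<close> itself. They are adjacent and share the source i, so
  the order condition of G holds.\<close>

lemma cube_antidiagonal:
  assumes "cube (Suc n) f" "i < n"
  shows "cube n (\<lambda>v. f (face_emb (Suc i) (\<not> v ! i) v))"
  using assms(1)
proof (rule cube_morphism)
  show "G_morphism n (Suc n) (\<lambda>v. face_emb (Suc i) (\<not> v ! i) v)"
  proof (rule G_morphismI[where src = "\<lambda>j. if j \<le> i then j else j - 1"
        and h = "\<lambda>j c. if j = i then \<not> c else c"])
    show "mono (\<lambda>j. if j \<le> i then j else j - 1)" by (auto simp: mono_def)
  qed (use assms(2) in \<open>auto simp: length_face_emb nth_face_emb\<close>)
qed

text \<open>By ergodicity any two points form an edge, which is pulled back along the last
  coordinate.\<close>

lemma cube_last: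
  assumes "a \<in> points X" "b \<in> points X" "0 < n"
  shows "cube n (\<lambda>v. if v ! (n - 1) then b else a)"
proof -
  have "restrict (\<lambda>v. if hd v then b else a) (vertices 1) \<in> cubes X 1"
    using groupspace assms unfolding groupspace_def ergodic_def by auto
  then have "cube 1 (\<lambda>v. if hd v then b else a)" by (simp add: cube_def)
  moreover have "G_morphism n 1 (\<lambda>v. [v ! (n - 1)])"
    by (rule G_morphismI[where src = "\<lambda>_. n - 1" and h = "\<lambda>_ c. c"]) (use assms in \<open>auto simp: mono_def\<close>)
  ultimately have "cube n (\<lambda>v. if hd [v ! (n - 1)] then b else a)"
    by (rule cube_morphism)
  then show ?thesis by simp
qed

section \<open>Completing partial cubes and gluing\<close>

lemma corner_restrict:
  assumes "\<And>i. i < n \<Longrightarrow> cube (n - 1) (\<lambda>x. f (face_emb (Suc i) False x))"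
  shows "corner X n (restrict f (vertices_star n))"
proof -
  let ?f = "restrict f (vertices_star n)"
  \<comment> \<open>A vertex other than the vertex of ones has a zero coordinate, hence lies on a
    lower face, where the values are known to be points.\<close>
  have pt: "f v \<in> points X" if v: "length v = n" "v \<noteq> all_ones n" for v
  proof -
    obtain i where i: "i < n" "\<not> v ! i" using v vertex_ones_iff by blast
    then have "f (face_emb (Suc i) False (del i v)) \<in> points X"
      using cube_points[OF assms[OF i(1)], of "del i v"] v by (simp add: length_del)
    then show ?thesis using i v by (simp add: face_emb_del)
  qed
  show ?thesis
    unfolding corner_def
  proof (intro conjI ballI)
    show "?f \<in> vertices_star n \<rightarrow>\<^sub>E points X"
      using pt by (auto simp: vertices_star_def vertices_def)
  next
    fix i assume i: "i \<in> {1..n}"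
    then obtain j where j: "i = Suc j" "j < n" by (cases i) auto
    have "compose (vertices (n - 1)) ?f (face_emb i False)
        = restrict (\<lambda>x. f (face_emb i False x)) (vertices (n - 1))"
      unfolding compose_def
    proof (rule restrict_ext)
      fix x assume x: "x \<in> vertices (n - 1)"
      then have "length (face_emb i False x) = n" "\<not> face_emb i False x ! j"
        using j by (auto simp: vertices_def length_face_emb nth_face_emb)
      then have "face_emb i False x \<in> vertices_star n"
        using j vertex_ones_iff by (auto simp: vertices_star_def vertices_def)
      then show "?f (face_emb i False x) = f (face_emb i False x)" by simp
    qed
    then show "compose (vertices (n - 1)) ?f (face_emb i False) \<in> cubes X (n - 1)"
      using assms[OF j(2)] j(1) by (simp add: cube_def)
  qed
qed

lemma corner_completion:
  assumes "\<And>i. i < n \<Longrightarrow> cube (n - 1) (\<lambda>x. f (face_emb (Suc i) False x))"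
  shows "\<exists>g. cube n g \<and> (\<forall>v. length v = n \<and> v \<noteq> all_ones n \<longrightarrow> g v = f v)"
proof -
  obtain g where g: "completes X n (restrict f (vertices_star n)) g"
    using groupspace corner_restrict[OF assms] unfolding groupspace_def completion_def by blast
  have "g v = f v" if "length v = n" "v \<noteq> all_ones n" for v
  proof -
    have "v \<in> vertices_star n" using that by (simp add: vertices_star_def vertices_def)
    then show ?thesis using g by (metis completes_def restrict_apply')
  qed
  moreover have "cube n g" using g by (auto simp: completes_def intro: cube_cubes)
  ultimately show ?thesis by blast
qed

text \<open>The missing lower faces are filled in one at a time, each by the same statement one
  dimension lower; once all lower faces are present, the corner is completed.\<close>

lemma fill_lower_faces:
  assumes "\<And>i. i < n \<Longrightarrow> J i \<Longrightarrow> cube (n - 1) (\<lambda>x. f (face_emb (Suc i) False x))"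
  shows "\<exists>g. cube n g \<and> (\<forall>v i. length v = n \<and> i < n \<and> J i \<and> \<not> v ! i \<longrightarrow> g v = f v)"
  using assms
\<comment> \<open>Both uses of the induction hypothesis lower this sum: passing to a face drops the
  dimension without adding missing faces, and supplying a face drops the number of missing
  ones.\<close>
proof (induction "n + card {i. i < n \<and> \<not> J i}" arbitrary: n J f rule: less_induct)
  case less
  show ?case
  proof (cases "\<forall>i<n. J i")
    case True
    have "\<exists>g. cube n g \<and> (\<forall>v. length v = n \<and> v \<noteq> all_ones n \<longrightarrow> g v = f v)"
      by (rule corner_completion) (use less.prems True in simp)
    then obtain g where g: "cube n g" "\<And>v. length v = n \<Longrightarrow> v \<noteq> all_ones n \<Longrightarrow> g v = f v"
      by blast
    then show ?thesis using vertex_ones_iff by blast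
  next
    case False
    then obtain i where i: "i < n" "\<not> J i" by blast
    then obtain m where n: "n = Suc m" by (cases n) auto
    let ?f = "\<lambda>x. f (face_emb (Suc i) False x)"
    have "card {j. j < m \<and> \<not> J (skip i j)} \<le> card {j. j < n \<and> \<not> J j}"
    proof (rule card_inj_on_le)
      show "inj_on (skip i) {j. j < m \<and> \<not> J (skip i j)}"
        by (auto simp: inj_on_def skip_def split: if_splits)
      show "skip i ` {j. j < m \<and> \<not> J (skip i j)} \<subseteq> {j. j < n \<and> \<not> J j}"
        using n by (auto simp: skip_def)
    qed simp
    then have "m + card {j. j < m \<and> \<not> J (skip i j)} < n + card {j. j < n \<and> \<not> J j}"
      using n by simp
    moreover have "cube (m - 1) (\<lambda>y. ?f (face_emb (Suc j) False y))" if j: "j < m" "J (skip i j)" for j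
    proof -
      \<comment> \<open>The position of direction i inside the face in direction
        \<open>skip i j\<close>: it moves down by one exactly if the removed direction precedes
        it.\<close>
      let ?i = "if j < i then i - 1 else i"
      obtain l where l: "m = Suc l" using j by (cases m) auto
      have sk: "skip i j < n" using j n by (simp add: skip_def)
      have "cube m (\<lambda>x. f (face_emb (Suc (skip i j)) False x))"
        using less.prems[OF sk j(2)] n by simp
      then have "cube l (\<lambda>y. f (face_emb (Suc (skip i j)) False (face_emb (Suc ?i) False y)))"
        unfolding l by (rule cube_face) (use i(1) n l j in auto)
      also have "?this = cube l (\<lambda>y. ?f (face_emb (Suc j) False y))"
      proof (rule cube_cong)
        fix y :: "bool list" assume y: "length y = l"
        show "f (face_emb (Suc (skip i j)) False (face_emb (Suc ?i) False y))
            = ?f (face_emb (Suc j) False y)"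
        proof (cases "j < i")
          case True
          then show ?thesis
            using y i n l face_emb_commute[of j "i - 1" y False False] by (simp add: skip_def)
        next
          case False
          then show ?thesis
            using y j l face_emb_commute[of i j y False False] by (simp add: skip_def)
        qed
      qed
      finally show ?thesis using l by simp
    qed
    ultimately have "\<exists>h. cube m h \<and>
        (\<forall>v j. length v = m \<and> j < m \<and> J (skip i j) \<and> \<not> v ! j \<longrightarrow> h v = ?f v)"
      by (rule less.hyps)
    then obtain h where h: "cube m h"
      "\<And>v j. length v = m \<Longrightarrow> j < m \<Longrightarrow> J (skip i j) \<Longrightarrow> \<not> v ! j \<Longrightarrow> h v = ?f v"
      by blast
    \<comment> \<open>The missing lower face in direction i is overwritten by h;
      \<open>agree\<close> shows that the prescribed faces keep their values.\<close>
    let ?g = "\<lambda>v. if v ! i then f v else h (del i v)"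
    have agree: "?g v = f v" if v: "length v = n" "j < n" "J j" "\<not> v ! j" for v j
    proof (cases "v ! i")
      case False
      obtain j' where j': "j' < m" "j = skip i j'"
      proof
        show "(if j < i then j else j - 1) < m" "j = skip i (if j < i then j else j - 1)"
          using v i n by (cases "i = j"; auto simp: skip_def)+
      qed
      have "h (del i v) = ?f (del i v)"
        using v i n j' by (intro h(2)[of _ j']) (auto simp: length_del nth_del)
      then show ?thesis
        using False v i face_emb_del[of i v False] by simp
    qed simp
    have "card {j. j < n \<and> \<not> (J j \<or> j = i)} < card {j. j < n \<and> \<not> J j}"
      using i by (intro psubset_card_mono) auto
    moreover have "cube (n - 1) (\<lambda>x. ?g (face_emb (Suc j) False x))" if j: "j < n" "J j \<or> j = i" for j
    proof (cases "j = i")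
      case True
      then have "cube (n - 1) (\<lambda>x. ?g (face_emb (Suc j) False x)) = cube m h"
        unfolding n diff_Suc_1 using i n
        by (intro cube_cong) (simp add: nth_face_emb del_face_emb)
      then show ?thesis using h(1) by simp
    next
      case False
      then have "cube (n - 1) (\<lambda>x. ?g (face_emb (Suc j) False x))
          = cube (n - 1) (\<lambda>x. f (face_emb (Suc j) False x))"
        using j n by (intro cube_cong agree[of _ j]) (auto simp: length_face_emb nth_face_emb)
      then show ?thesis using less.prems[of j] j False by simp
    qed
    ultimately have "\<exists>g. cube n g \<and>
        (\<forall>v j. length v = n \<and> j < n \<and> (J j \<or> j = i) \<and> \<not> v ! j \<longrightarrow> g v = ?g v)"
      by (intro less.hyps) auto
    then obtain g where g: "cube n g"
      "\<And>v j. length v = n \<Longrightarrow> j < n \<Longrightarrow> J j \<or> j = i \<Longrightarrow> \<not> v ! j \<Longrightarrow> g v = ?g v"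
      by blast
    have "g v = f v" if "length v = n" "j < n" "J j" "\<not> v ! j" for v j
      using g(2)[of v j] agree[of v j] that by simp
    with g(1) show ?thesis by blast
  qed
qed

text \<open>The two cubes are placed along the two lower faces of a cube in which coordinate i is
  doubled. The glued cube is then the antidiagonal, an order preserving section of the doubling.\<close>

lemma cube_glue:
  assumes "cube n c" "cube n c'" "i < n"
    and shared: "\<And>v. length v = n \<Longrightarrow> c (v[i := True]) = c' (v[i := False])"
  shows "cube n (\<lambda>v. if v ! i then c' v else c v)"
proof -
  \<comment> \<open>The lower face in direction i is c', the one in direction \<open>Suc i\<close>
    is c reflected in direction i. The reflection makes both agree on their intersection by
    \<open>shared\<close>, and the antidiagonal later undoes it.\<close>
  let ?f = "\<lambda>z. if \<not> z ! i then c' (del i z) else c ((del (Suc i) z)[i := False])"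
  have "cube (Suc n - 1) (\<lambda>x. ?f (face_emb (Suc j) False x))" if "j = i \<or> j = Suc i" for j
  proof (cases "j = i")
    case True
    then have "cube n (\<lambda>x. ?f (face_emb (Suc j) False x)) = cube n c'"
      using assms(3) by (intro cube_cong) (simp add: nth_face_emb del_face_emb)
    then show ?thesis using assms(2) by simp
  next
    case False
    with that have j: "j = Suc i" by simp
    have "cube n (\<lambda>x. ?f (face_emb (Suc j) False x)) =
      cube n (\<lambda>v. c (map (\<lambda>a. if a = i then \<not> v ! a else v ! a) [0..<n]))"
    proof (rule cube_cong)
      fix v :: "bool list" assume v: "length v = n"
      have flip: "map (\<lambda>a. if a = i then \<not> v ! a else v ! a) [0..<n] = v[i := \<not> v ! i]"
        using v by (intro nth_equalityI) (auto simp: nth_list_update)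
      show "?f (face_emb (Suc j) False v) = c (map (\<lambda>a. if a = i then \<not> v ! a else v ! a) [0..<n])"
      proof (cases "v ! i")
        case True
        then show ?thesis using v j assms(3) flip by (simp add: nth_face_emb del_face_emb)
      next
        case False
        have "del i (face_emb (Suc j) False v) = v[i := False]"
          using v j assms(3) False
          by (intro nth_equalityI)
            (auto simp: length_del nth_del length_face_emb nth_face_emb skip_def nth_list_update)
        then show ?thesis using v j assms(3) flip False shared[OF v] by (simp add: nth_face_emb)
      qed
    qed
    then show ?thesis
      unfolding diff_Suc_1
      using cube_coordinatewise[OF assms(1), of "\<lambda>a b. if a = i then \<not> b else b"] by (rule iffD2)
  qed
  then have "\<exists>g. cube (Suc n) g \<and>
      (\<forall>v j. length v = Suc n \<and> j < Suc n \<and> (j = i \<or> j = Suc i) \<and> \<not> v ! j \<longrightarrow> g v = ?f v)"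
    by (rule fill_lower_faces[of "Suc n" "\<lambda>j. j = i \<or> j = Suc i" ?f])
  then obtain g where g: "cube (Suc n) g"
    "\<And>v j. length v = Suc n \<Longrightarrow> j < Suc n \<Longrightarrow> j = i \<or> j = Suc i \<Longrightarrow> \<not> v ! j \<Longrightarrow> g v = ?f v"
    by blast
  have "g (face_emb (Suc i) (\<not> v ! i) v) = (if v ! i then c' v else c v)" if v: "length v = n" for v
  proof -
    let ?z = "face_emb (Suc i) (\<not> v ! i) v"
    have z: "length ?z = Suc n" "?z ! i = (\<not> v ! i)" "?z ! Suc i = v ! i"
      using v assms(3) by (auto simp: length_face_emb nth_face_emb)
    have "g ?z = ?f ?z"
    proof (cases "v ! i")
      case True
      show ?thesis by (rule g(2)[OF z(1), of i]) (use z True assms(3) in auto)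
    next
      case False
      show ?thesis by (rule g(2)[OF z(1), of "Suc i"]) (use z False assms(3) in auto)
    qed
    moreover have "(del (Suc i) ?z)[i := False] = v" if "\<not> v ! i"
      using v assms(3) that
      by (intro nth_equalityI)
        (auto simp: length_del nth_del length_face_emb nth_face_emb skip_def nth_list_update dest!: less_antisym)
    ultimately show ?thesis
      using z v assms(3) by (simp add: del_face_emb)
  qed
  then have "cube n (\<lambda>v. g (face_emb (Suc i) (\<not> v ! i) v)) = cube n (\<lambda>v. if v ! i then c' v else c v)"
    by (rule cube_cong)
  then show ?thesis
    using cube_antidiagonal[OF g(1) assms(3)] by (rule iffD1)
qed

section \<open>Assembling a cube from the blocks of a grid\<close>

text \<open>\<open>T\<close> labels a grid subdivided in the directions of A, and E selects a unit
  block. For the induction, a direction j is frozen to \<open>lo\<close> or \<open>hi\<close>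
  through \<open>base\<close>; the two resulting outer cubes share the slice where coordinate j is
  1, and \<open>cube_glue\<close> merges them.\<close>

lemma cube_outer:
  fixes T :: "(nat \<Rightarrow> nat) \<Rightarrow> 'a"
  assumes "A \<subseteq> {..<n}"
    and "\<And>E. \<forall>a\<in>A. E a \<in> {lo, hi} \<Longrightarrow> cube n (\<lambda>v. T (\<lambda>a. (if a \<in> A then E a else base a) (v ! a)))"
  shows "cube n (\<lambda>v. T (\<lambda>a. (if a \<in> A then outer else base a) (v ! a)))"
proof -
  have "finite A" using assms(1) finite_subset by blast
  then show ?thesis
    using assms
  proof (induction A arbitrary: base rule: finite_induct)
    case empty
    then show ?case by simp
  next
    case (insert j A)
    have step: "cube n (\<lambda>v. T (\<lambda>a. (if a \<in> A then outer else (base(j := g)) a) (v ! a)))"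
      if g: "g \<in> {lo, hi}" for g
    proof (rule insert.IH)
      show "A \<subseteq> {..<n}" using insert.prems(1) by simp
      fix E :: "nat \<Rightarrow> bool \<Rightarrow> nat" assume E: "\<forall>a\<in>A. E a \<in> {lo, hi}"
      have "(\<lambda>a. if a \<in> A then E a else (base(j := g)) a)
          = (\<lambda>a. if a \<in> insert j A then (E(j := g)) a else base a)"
        using insert.hyps by (auto simp: fun_eq_iff)
      moreover have "cube n (\<lambda>v. T (\<lambda>a. (if a \<in> insert j A then (E(j := g)) a else base a) (v ! a)))"
        by (rule insert.prems(2)) (use E g in auto)
      ultimately show "cube n (\<lambda>v. T (\<lambda>a. (if a \<in> A then E a else (base(j := g)) a) (v ! a)))"
        by metis
    qed
    let ?m = "\<lambda>g a. if a \<in> A then outer else (base(j := g)) a"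
    have j: "j < n" using insert.prems(1) by simp
    have "cube n (\<lambda>v. if v ! j then T (\<lambda>a. ?m hi a (v ! a)) else T (\<lambda>a. ?m lo a (v ! a)))"
    proof (rule cube_glue[OF step[of lo] step[of hi] j])
      fix v :: "bool list" assume v: "length v = n"
      have "(\<lambda>a. ?m lo a (v[j := True] ! a)) = (\<lambda>a. ?m hi a (v[j := False] ! a))"
        using v j insert.hyps by (auto simp: fun_eq_iff lo_def hi_def)
      then show "T (\<lambda>a. ?m lo a (v[j := True] ! a)) = T (\<lambda>a. ?m hi a (v[j := False] ! a))"
        by (rule arg_cong)
    qed simp_all
    also have "?this = cube n (\<lambda>v. T (\<lambda>a. (if a \<in> insert j A then outer else base a) (v ! a)))"
    proof (rule cube_cong)
      fix v :: "bool list"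
      have "(if v ! j then T (\<lambda>a. ?m hi a (v ! a)) else T (\<lambda>a. ?m lo a (v ! a)))
          = T (\<lambda>a. ?m (if v ! j then hi else lo) a (v ! a))"
        by (cases "v ! j") simp_all
      also have "(\<lambda>a. ?m (if v ! j then hi else lo) a (v ! a))
          = (\<lambda>a. (if a \<in> insert j A then outer else base a) (v ! a))"
        using insert.hyps by (auto simp: fun_eq_iff lo_def hi_def outer_def)
      finally show "(if v ! j then T (\<lambda>a. ?m hi a (v ! a)) else T (\<lambda>a. ?m lo a (v ! a)))
          = T (\<lambda>a. (if a \<in> insert j A then outer else base a) (v ! a))" .
    qed
    finally show ?case .
  qed
qed

text \<open>The cube c2 occupies the last block of a grid and reflections of c1 the others, so that
  every vertex of the outer cube but the last one carries the value of c1 at the vertex of ones.\<close>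

lemma cube_spike:
  assumes "cube k c1" "cube k c2" "\<And>v. length v = k \<Longrightarrow> v \<noteq> all_ones k \<Longrightarrow> c1 v = c2 v"
  shows "cube k (spike k (c1 (all_ones k)) (c2 (all_ones k)))"
proof -
  let ?A = "{..<k}"
  \<comment> \<open>The test \<open>u a \<noteq> 1\<close> folds the grid at 1: both 0 and 2 become
    True. Thus all corners of the outer cube land on the vertex of ones, and only the top corner is
    relabelled by c2. A block with some direction \<open>lo\<close> never meets the top
    corner.\<close>
  let ?T = "\<lambda>u::nat \<Rightarrow> nat. if \<forall>a<k. u a = 2 then c2 (all_ones k) else c1 (map (\<lambda>a. u a \<noteq> 1) [0..<k])"
  have "cube k (\<lambda>v. ?T (\<lambda>a. (if a \<in> ?A then outer else lo) (v ! a)))"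
  proof (rule cube_outer)
    fix E :: "nat \<Rightarrow> bool \<Rightarrow> nat" assume E: "\<forall>a\<in>?A. E a \<in> {lo, hi}"
    show "cube k (\<lambda>v. ?T (\<lambda>a. (if a \<in> ?A then E a else lo) (v ! a)))"
    proof (cases "\<forall>a<k. E a = hi")
      case True
      have "?T (\<lambda>a. (if a \<in> ?A then E a else lo) (v ! a)) = c2 v" if v: "length v = k" for v
      proof -
        have "map (\<lambda>a. (if a \<in> ?A then E a else lo) (v ! a) \<noteq> 1) [0..<k] = v"
          using v True by (intro nth_equalityI) (auto simp: hi_def)
        moreover have "(\<forall>a<k. (if a \<in> ?A then E a else lo) (v ! a) = 2) \<longleftrightarrow> v = all_ones k"
          using v True by (auto simp: hi_def vertex_ones_iff)
        ultimately show ?thesis using assms(3)[OF v] by simp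
      qed
      then show ?thesis using assms(2) by (rule iffD2[OF cube_cong])
    next
      case False
      then obtain j where j: "j < k" "E j = lo" using E by auto
      have "?T (\<lambda>a. (if a \<in> ?A then E a else lo) (v ! a))
          = c1 (map (\<lambda>a. (\<lambda>a b. E a b \<noteq> 1) a (v ! a)) [0..<k])" if "length v = k" for v
      proof -
        have "(if j \<in> ?A then E j else lo) (v ! j) \<noteq> 2" using j by (simp add: lo_def)
        moreover have "map (\<lambda>a. (if a \<in> ?A then E a else lo) (v ! a) \<noteq> 1) [0..<k]
            = map (\<lambda>a. (\<lambda>a b. E a b \<noteq> 1) a (v ! a)) [0..<k]"
          by (intro nth_equalityI) auto
        ultimately show ?thesis using j(1) by metis
      qed
      moreover have "cube k (\<lambda>v. c1 (map (\<lambda>a. (\<lambda>a b. E a b \<noteq> 1) a (v ! a)) [0..<k]))"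
        by (rule cube_coordinatewise[OF assms(1)])
      ultimately show ?thesis by (rule iffD2[OF cube_cong])
    qed
  qed simp
  moreover have "?T (\<lambda>a. (if a \<in> ?A then outer else lo) (v ! a)) = spike k (c1 (all_ones k)) (c2 (all_ones k)) v"
    if v: "length v = k" for v
  proof -
    have "map (\<lambda>a. (if a \<in> ?A then outer else lo) (v ! a) \<noteq> 1) [0..<k] = all_ones k"
      by (intro nth_equalityI) (auto simp: outer_def all_ones_def)
    moreover have "(\<forall>a<k. (if a \<in> ?A then outer else lo) (v ! a) = 2) \<longleftrightarrow> v = all_ones k"
      using v by (auto simp: outer_def vertex_ones_iff)
    ultimately show ?thesis by (simp add: spike_def)
  qed
  ultimately show ?thesis by (rule iffD1[OF cube_cong, rotated])
qed

section \<open>Operations on pairs of opposite faces\<close>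

lemma cube_pair_left: "cube (Suc k) (pair k c d) \<Longrightarrow> cube k c"
  using cube_face[of k "pair k c d" k False]
    cube_cong[of k "\<lambda>x. pair k c d (face_emb (Suc k) False x)" c]
  by (simp add: pair_face_last)

lemma cube_pair_right: "cube (Suc k) (pair k c d) \<Longrightarrow> cube k d"
  using cube_face[of k "pair k c d" k True]
    cube_cong[of k "\<lambda>x. pair k c d (face_emb (Suc k) True x)" d]
  by (simp add: pair_face_last)

lemma cube_pair_reflect:
  assumes "cube (Suc k) (pair k c d)"
  shows "cube (Suc k) (pair k (\<lambda>v. c (map (\<lambda>a. h a (v ! a)) [0..<k])) (\<lambda>v. d (map (\<lambda>a. h a (v ! a)) [0..<k])))"
proof -
  let ?h = "\<lambda>a b. if a = k then b else h a b"
  have "pair k c d (map (\<lambda>a. ?h a (v ! a)) [0..<Suc k])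
     = pair k (\<lambda>v. c (map (\<lambda>a. h a (v ! a)) [0..<k])) (\<lambda>v. d (map (\<lambda>a. h a (v ! a)) [0..<k])) v"
    if "length v = Suc k" for v
  proof -
    have "take k (map (\<lambda>a. ?h a (v ! a)) [0..<Suc k]) = map (\<lambda>a. h a (take k v ! a)) [0..<k]"
      using that by (intro nth_equalityI) (auto simp: nth_append)
    moreover have "map (\<lambda>a. ?h a (v ! a)) [0..<Suc k] ! k = v ! k" by (simp add: nth_append)
    ultimately have "pair k c d (map (\<lambda>a. ?h a (v ! a)) [0..<Suc k]) =
        (if v ! k then d (map (\<lambda>a. h a (take k v ! a)) [0..<k]) else c (map (\<lambda>a. h a (take k v ! a)) [0..<k]))"
      by (rule pair_eq)
    then show ?thesis by (simp only: pair_def)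
  qed
  then show ?thesis
    using cube_coordinatewise[OF assms, of ?h] by (rule iffD1[OF cube_cong])
qed

lemma cube_pair_swap:
  assumes "cube (Suc k) (pair k c d)"
  shows "cube (Suc k) (pair k d c)"
proof -
  let ?h = "\<lambda>a b. if a = k then \<not> b else b"
  have "pair k c d (map (\<lambda>a. ?h a (v ! a)) [0..<Suc k]) = pair k d c v"
    if "length v = Suc k" for v
  proof -
    have "take k (map (\<lambda>a. ?h a (v ! a)) [0..<Suc k]) = take k v"
      using that by (intro nth_equalityI) (auto simp: nth_append)
    moreover have "map (\<lambda>a. ?h a (v ! a)) [0..<Suc k] ! k = (\<not> v ! k)" by (simp add: nth_append)
    ultimately have "pair k c d (map (\<lambda>a. ?h a (v ! a)) [0..<Suc k]) =
        (if \<not> v ! k then d (take k v) else c (take k v))"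
      by (rule pair_eq)
    also have "\<dots> = pair k d c v" by (simp add: pair_def)
    finally show ?thesis .
  qed
  then show ?thesis
    using cube_coordinatewise[OF assms, of ?h] by (rule iffD1[OF cube_cong])
qed

text \<open>The given pair and the pair of spikes are placed in two blocks of a grid, meeting in the
  edge at the vertex of ones.\<close>

lemma cube_pair_update_ones:
  assumes g: "cube (Suc k) (pair k c d)"
    and s: "cube (Suc k) (pair k (spike k (c (all_ones k)) x) (spike k (d (all_ones k)) y))"
  shows "cube (Suc k) (pair k (c(all_ones k := x)) (d(all_ones k := y)))"
proof -
  let ?A = "{..<k}"
  \<comment> \<open>The test \<open>u a \<noteq> 0\<close> collapses 1 and 2, so a block with some
    direction \<open>lo\<close> is the given pair or a degenerate image of it, while the block with
    all directions \<open>hi\<close> is the pair of spikes. Direction k is not subdivided and is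
    read by \<open>lo\<close> as 0 or 1.\<close>
  let ?T = "\<lambda>u::nat \<Rightarrow> nat. if \<forall>a<k. u a = 2 then (if u k \<noteq> 0 then y else x)
    else pair k c d (map (\<lambda>a. u a \<noteq> 0) [0..<Suc k])"
  have ones: "take k v = all_ones k \<longleftrightarrow> (\<forall>a<k. v ! a)" if "length v = Suc k" for v :: "bool list"
    using that vertex_ones_iff[of "take k v" k] by simp
  have "cube (Suc k) (\<lambda>v. ?T (\<lambda>a. (if a \<in> ?A then outer else lo) (v ! a)))"
  proof (rule cube_outer)
    fix E :: "nat \<Rightarrow> bool \<Rightarrow> nat" assume E: "\<forall>a\<in>?A. E a \<in> {lo, hi}"
    show "cube (Suc k) (\<lambda>v. ?T (\<lambda>a. (if a \<in> ?A then E a else lo) (v ! a)))"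
    proof (cases "\<forall>a<k. E a = hi")
      case True
      have "?T (\<lambda>a. (if a \<in> ?A then E a else lo) (v ! a))
          = pair k (spike k (c (all_ones k)) x) (spike k (d (all_ones k)) y) v"
        if v: "length v = Suc k" for v
      proof -
        let ?w = "map (\<lambda>a. (if a \<in> ?A then E a else lo) (v ! a) \<noteq> 0) [0..<Suc k]"
        have "take k ?w = all_ones k"
          using True by (intro nth_equalityI) (auto simp: hi_def all_ones_def nth_append)
        moreover have "?w ! k = v ! k" by (simp add: lo_def nth_append)
        moreover have "(\<forall>a<k. (if a \<in> ?A then E a else lo) (v ! a) = 2) \<longleftrightarrow> take k v = all_ones k"
          unfolding ones[OF v] using True by (auto simp: hi_def)
        moreover have "(if k \<in> ?A then E k else lo) (v ! k) \<noteq> 0 \<longleftrightarrow> v ! k" by (simp add: lo_def)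
        ultimately show ?thesis by (auto simp only: pair_def spike_def split: if_split)
      qed
      then show ?thesis using s by (rule iffD2[OF cube_cong])
    next
      case False
      then obtain j where j: "j < k" "E j = lo" using E by auto
      let ?h = "\<lambda>a b. (if a \<in> ?A then E a else lo) b \<noteq> 0"
      have "?T (\<lambda>a. (if a \<in> ?A then E a else lo) (v ! a))
          = pair k c d (map (\<lambda>a. ?h a (v ! a)) [0..<Suc k])"
        if "length v = Suc k" for v
      proof (rule if_not_P)
        have "(if j \<in> ?A then E j else lo) (v ! j) \<noteq> 2" using j by (simp add: lo_def)
        then show "\<not> (\<forall>a<k. (if a \<in> ?A then E a else lo) (v ! a) = 2)" using j(1) by blast
      qed
      moreover have "cube (Suc k) (\<lambda>v. pair k c d (map (\<lambda>a. ?h a (v ! a)) [0..<Suc k]))"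
        by (rule cube_coordinatewise[OF g])
      ultimately show ?thesis by (rule iffD2[OF cube_cong])
    qed
  qed auto
  moreover have "?T (\<lambda>a. (if a \<in> ?A then outer else lo) (v ! a))
      = pair k (c(all_ones k := x)) (d(all_ones k := y)) v"
    if v: "length v = Suc k" for v
  proof -
    have "map (\<lambda>a. (if a \<in> ?A then outer else lo) (v ! a) \<noteq> 0) [0..<Suc k] = v"
      using v by (intro nth_equalityI) (auto simp: outer_def lo_def nth_append less_Suc_eq)
    moreover have "(\<forall>a<k. (if a \<in> ?A then outer else lo) (v ! a) = 2) \<longleftrightarrow> take k v = all_ones k"
      unfolding ones[OF v] by (auto simp: outer_def)
    ultimately show ?thesis by (simp add: pair_def lo_def del: upt_Suc)
  qed
  ultimately show ?thesis by (rule iffD1[OF cube_cong, rotated])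
qed

lemma cube_const:
  assumes "p \<in> points X" "0 < n"
  shows "cube n (\<lambda>_. p)"
  using cube_last[OF assms(1,1,2)] by simp

end

section \<open>Unique completion and the correspondence between fibers\<close>

locale step_groupspace_loc = groupspace_loc X for X :: "'a cube_structure" +
  fixes k :: nat
  assumes k_pos: "0 < k"
    and unique: "corner X (k + 1) f \<Longrightarrow> \<exists>!\<phi>. completes X (k + 1) f \<phi>"
begin

text \<open>Uniqueness passes from dimension k + 1 to higher dimensions by restricting to the upper
  face in the first direction, whose vertex of ones is that of the whole cube.\<close>

lemma cube_unique:
  assumes "k < n" "cube n g" "cube n h"
    and "\<And>v. length v = n \<Longrightarrow> v \<noteq> all_ones n \<Longrightarrow> g v = h v"
  shows "g (all_ones n) = h (all_ones n)"
proof -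
  have "Suc k \<le> n" using assms(1) by simp
  then show ?thesis
    using assms(2-4)
  proof (induction n arbitrary: g h rule: dec_induct)
    case base
    let ?r = "\<lambda>f. restrict f (vertices (Suc k))"
    have star: "vertices (Suc k) \<inter> vertices_star (Suc k) = vertices_star (Suc k)"
      by (auto simp: vertices_star_def)
    have eq: "restrict h (vertices_star (Suc k)) = restrict g (vertices_star (Suc k))"
      using base.prems(3) by (intro restrict_ext) (simp add: vertices_star_def vertices_def)
    have "corner X (k + 1) (restrict g (vertices_star (k + 1)))"
      by (rule corner_restrict) (use cube_face[OF base.prems(1)] in simp)
    moreover have "completes X (k + 1) (restrict g (vertices_star (k + 1))) (?r g)"
      "completes X (k + 1) (restrict g (vertices_star (k + 1))) (?r h)"
      using base.prems(1,2) star eq by (simp_all add: completes_def cube_def)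
    ultimately have "?r g = ?r h" using unique by blast
    then have "?r g (all_ones (Suc k)) = ?r h (all_ones (Suc k))" by simp
    then show ?case by (simp add: vertices_def all_ones_def)
  next
    case (step n)
    have ones: "face_emb (Suc 0) True v = all_ones (Suc n) \<longleftrightarrow> v = all_ones n" for v
      by (simp add: face_emb_def all_ones_def)
    have "g (face_emb (Suc 0) True (all_ones n)) = h (face_emb (Suc 0) True (all_ones n))"
      by (rule step.IH[OF cube_face[OF step.prems(1)] cube_face[OF step.prems(2)]])
        (use step.prems(3) ones in \<open>simp_all add: length_face_emb\<close>)
    then show ?case using ones by metis
  qed
qed

text \<open>For fixed base points p and q, this relation is the graph of the isomorphism from the fiber of
  p to the fiber of q.\<close>

definition prism :: "'a \<Rightarrow> 'a \<Rightarrow> 'a \<Rightarrow> 'a \<Rightarrow> bool" where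
  "prism p q x y \<longleftrightarrow> cube (Suc k) (pair k (spike k p x) (spike k q y))"

lemma prism_left: "prism p q x y \<Longrightarrow> cube k (spike k p x)"
  unfolding prism_def by (rule cube_pair_left)

lemma prism_right: "prism p q x y \<Longrightarrow> cube k (spike k q y)"
  unfolding prism_def by (rule cube_pair_right)

lemma prism_sym: "prism p q x y \<Longrightarrow> prism q p y x"
  unfolding prism_def by (rule cube_pair_swap)

lemma ones_Suc_iff: "length v = Suc k \<Longrightarrow> v = all_ones (Suc k) \<longleftrightarrow> take k v = all_ones k \<and> v ! k"
  using vertex_ones_iff[of v "Suc k"] vertex_ones_iff[of "take k v" k] by (auto simp: less_Suc_eq)

lemma pair_ones: "pair k c d (all_ones (Suc k)) = d (all_ones k)"
  using ones_Suc_iff[of "all_ones (Suc k)"] by (simp add: pair_def all_ones_def)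

lemma prism_unique:
  assumes "prism p q x y" "prism p q x y'"
  shows "y = y'"
proof -
  have "pair k (spike k p x) (spike k q y) (all_ones (Suc k))
      = pair k (spike k p x) (spike k q y') (all_ones (Suc k))"
    by (rule cube_unique[OF _ assms[unfolded prism_def]]) (auto simp: ones_Suc_iff pair_def spike_def)
  then show ?thesis by (simp add: pair_ones) (simp add: spike_def)
qed

lemma spike_base:
  assumes "cube k (spike k p x)"
  shows "p \<in> points X"
proof -
  have "replicate k False \<noteq> all_ones k" using k_pos by (simp add: all_ones_def)
  then show ?thesis
    using cube_points[OF assms, of "replicate k False"] by (simp add: spike_def)
qed

text \<open>The lower face in the last direction is the given spike. Every other lower face misses
  the vertex carrying x, so it depends only on the last coordinate and is a cube by
  \<open>cube_last\<close>. The completion of this corner provides y at the vertex of ones.\<close>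

lemma prism_exists:
  assumes "cube k (spike k p x)" "q \<in> points X"
  obtains y where "prism p q x y"
proof -
  let ?f = "pair k (spike k p x) (\<lambda>_. q)"
  have "cube (Suc k - 1) (\<lambda>v. ?f (face_emb (Suc i) False v))" if i: "i < Suc k" for i
  proof (cases "i = k")
    case True
    have "cube k (\<lambda>v. ?f (face_emb (Suc i) False v)) = cube k (spike k p x)"
      by (rule cube_cong) (simp add: True pair_face_last)
    then show ?thesis using assms(1) by simp
  next
    case False
    obtain l where l: "k = Suc l" using k_pos by (cases k) auto
    have "cube k (\<lambda>v. ?f (face_emb (Suc i) False v)) = cube k (\<lambda>v. if v ! (k - 1) then q else p)"
    proof (rule cube_cong)
      fix v :: "bool list" assume v: "length v = k"
      have "\<not> face_emb (Suc i) False (take l v) ! i"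
        using v i False l by (simp add: nth_face_emb)
      moreover have "all_ones k ! i" using i False by (simp add: all_ones_def)
      ultimately have "face_emb (Suc i) False (take l v) \<noteq> all_ones k" by metis
      then show "?f (face_emb (Suc i) False v) = (if v ! (k - 1) then q else p)"
        using v i False l by (simp add: pair_face) (simp add: pair_def spike_def)
    qed
    then show ?thesis using cube_last[OF spike_base[OF assms(1)] assms(2) k_pos] by simp
  qed
  then have "\<exists>g. cube (Suc k) g \<and> (\<forall>v. length v = Suc k \<and> v \<noteq> all_ones (Suc k) \<longrightarrow> g v = ?f v)"
    by (rule corner_completion[of "Suc k" ?f])
  then obtain g where g: "cube (Suc k) g"
    "\<And>v. length v = Suc k \<Longrightarrow> v \<noteq> all_ones (Suc k) \<Longrightarrow> g v = ?f v"
    by blast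
  have "g v = pair k (spike k p x) (spike k q (g (all_ones (Suc k)))) v" if v: "length v = Suc k" for v
  proof (cases "v = all_ones (Suc k)")
    case True
    then show ?thesis by (simp add: pair_ones) (simp add: spike_def)
  next
    case False
    then show ?thesis
      using g(2)[OF v] ones_Suc_iff[OF v] by (auto simp: pair_def spike_def)
  qed
  then have "prism p q x (g (all_ones (Suc k)))"
    unfolding prism_def using g(1) by (rule iffD1[OF cube_cong])
  then show thesis by (rule that)
qed

text \<open>Starting from the constant pair (p, q), the edges are replaced one vertex at a time; a
  reflection moves the current vertex to the vertex of ones.\<close>

lemma prism_pair:
  assumes "\<And>v. length v = k \<Longrightarrow> prism p q (c v) (d v)"
  shows "cube (Suc k) (pair k c d)"
proof -
  have p: "p \<in> points X" and q: "q \<in> points X"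
    using assms[of "replicate k False"] spike_base prism_left prism_right by simp_all blast+
  have part: "cube (Suc k) (pair k (\<lambda>v. if v \<in> S then c v else p) (\<lambda>v. if v \<in> S then d v else q))"
    if "finite S" "S \<subseteq> vertices k" for S
    using that
  proof (induction S rule: finite_induct)
    case empty
    have "cube (Suc k) (\<lambda>v. if v ! (Suc k - 1) then q else p)"
      by (rule cube_last[OF p q]) simp
    then show ?case
      by (simp add: pair_def[abs_def])
  next
    case (insert u S)
    \<comment> \<open>Coordinate a is kept if \<open>u ! a\<close> holds and negated otherwise: an
      involution exchanging u with the vertex of ones.\<close>
    let ?r = "\<lambda>v. map (\<lambda>a. (\<lambda>a b. b = u ! a) a (v ! a)) [0..<k]"
    let ?c = "\<lambda>v. if v \<in> S then c v else p" and ?d = "\<lambda>v. if v \<in> S then d v else q"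
    let ?o = "all_ones k"
    have u: "length u = k" using insert.prems by (simp add: vertices_def)
    have ro: "?r ?o = u"
      using u by (intro nth_equalityI) (auto simp: all_ones_def)
    have rr: "?r (?r v) = v" if "length v = k" for v
      using that by (intro nth_equalityI) auto
    have r_ones: "?r v = ?o \<longleftrightarrow> v = u" if v: "length v = k" for v
    proof
      assume "?r v = ?o"
      then have "?r (?r v) = ?r ?o" by (rule arg_cong)
      then show "v = u" unfolding rr[OF v] ro .
    next
      assume "v = u"
      then show "?r v = ?o" by (intro nth_equalityI) (auto simp: all_ones_def)
    qed
    define c' where "c' = (\<lambda>v. ?c (?r v))"
    define d' where "d' = (\<lambda>v. ?d (?r v))"
    have "cube (Suc k) (pair k c' d')"
      unfolding c'_def d'_def
      by (rule cube_pair_reflect[of k ?c ?d "\<lambda>a b. b = u ! a"]) (use insert.IH insert.prems in simp)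
    \<comment> \<open>Since u is not in S, the edge at u still carries (p, q), as the spikes to be
      attached there require.\<close>
    moreover have o: "c' ?o = p" "d' ?o = q"
      unfolding c'_def d'_def ro using insert.hyps by simp_all
    have "cube (Suc k) (pair k (spike k (c' ?o) (c u)) (spike k (d' ?o) (d u)))"
      unfolding o using assms[OF u] unfolding prism_def .
    ultimately have "cube (Suc k) (pair k (c'(?o := c u)) (d'(?o := d u)))"
      by (rule cube_pair_update_ones)
    then have cu: "cube (Suc k) (pair k (\<lambda>v. (c'(?o := c u)) (?r v)) (\<lambda>v. (d'(?o := d u)) (?r v)))"
      by (rule cube_pair_reflect[of k _ _ "\<lambda>a b. b = u ! a"])
    have "(c'(?o := c u)) (?r v) = (if v \<in> insert u S then c v else p)
        \<and> (d'(?o := d u)) (?r v) = (if v \<in> insert u S then d v else q)" if v: "length v = k" for v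
    proof (cases "v = u")
      case True
      then show ?thesis using r_ones[OF v] by simp
    next
      case False
      then have "(c'(?o := c u)) (?r v) = c' (?r v)" "(d'(?o := d u)) (?r v) = d' (?r v)"
        using r_ones[OF v] by simp_all
      moreover have "c' (?r v) = ?c v" "d' (?r v) = ?d v"
        unfolding c'_def d'_def rr[OF v] by simp_all
      ultimately show ?thesis using False by simp
    qed
    then have "pair k (\<lambda>v. (c'(?o := c u)) (?r v)) (\<lambda>v. (d'(?o := d u)) (?r v)) v
      = pair k (\<lambda>v. if v \<in> insert u S then c v else p) (\<lambda>v. if v \<in> insert u S then d v else q) v"
      if "length v = Suc k" for v
      unfolding pair_def using that by simp
    then show ?case using cu by (rule iffD1[OF cube_cong])
  qed
  have "vertices k = {v. set v \<subseteq> UNIV \<and> length v = k}" by (simp add: vertices_def)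
  then have "finite (vertices k)" using finite_lists_length_eq[of "UNIV :: bool set" k] by simp
  then have cu: "cube (Suc k) (pair k (\<lambda>v. if v \<in> vertices k then c v else p)
      (\<lambda>v. if v \<in> vertices k then d v else q))"
    by (rule part) simp
  have "pair k (\<lambda>v. if v \<in> vertices k then c v else p) (\<lambda>v. if v \<in> vertices k then d v else q) v
    = pair k c d v" if "length v = Suc k" for v
    using that by (simp add: pair_def vertices_def)
  then show ?thesis using cu by (rule iffD1[OF cube_cong])
qed

text \<open>Extends \<open>prism_pair\<close> from dimension k to every dimension, as preservation
  of all cubes demands.\<close>

lemma prism_pair_cube:
  assumes "cube n c" "\<And>v. length v = n \<Longrightarrow> prism p q (c v) (d v)"
  shows "cube (Suc n) (pair n c d)"
  using assms
proof (induction n arbitrary: c d rule: less_induct)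
  case (less n)
  show ?case
  proof (cases "n \<le> k")
    case True
    \<comment> \<open>In dimension k, c and d are extended by ignoring the extra coordinates; this
      map inserts zeros for these before the last coordinate, which respects the order.\<close>
    let ?\<alpha> = "\<lambda>z. take n z @ replicate (k - n) False @ [z ! n]"
    have "cube (Suc k) (pair k (\<lambda>v. c (take n v)) (\<lambda>v. d (take n v)))"
      by (rule prism_pair[of p q]) (use less.prems(2) True in simp)
    moreover have "G_morphism (Suc n) (Suc k) ?\<alpha>"
      by (rule G_morphismI[where src = "\<lambda>j. min j n" and h = "\<lambda>j b. if n \<le> j \<and> j < k then False else b"])
        (use True in \<open>auto simp: nth_append mono_def min_def nth_Cons'\<close>)
    ultimately have "cube (Suc n) (\<lambda>z. pair k (\<lambda>v. c (take n v)) (\<lambda>v. d (take n v)) (?\<alpha> z))"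
      by (rule cube_morphism)
    moreover have "pair k (\<lambda>v. c (take n v)) (\<lambda>v. d (take n v)) (?\<alpha> z) = pair n c d z"
      if "length z = Suc n" for z
      using that True by (simp add: pair_def nth_append min_def)
    ultimately show ?thesis by (rule iffD1[OF cube_cong, rotated])
  next
    case False
    then obtain m where n: "n = Suc m" by (cases n) auto
    let ?f = "pair n c d"
    \<comment> \<open>Faces in all directions but the last are again pairs, over a face of c. Upper
      faces are included because the comparison at the vertex of ones takes place on one.\<close>
    have pair_low: "cube n (\<lambda>x. ?f (face_emb (Suc i) b x))" if i: "i \<le> m" for i b
    proof -
      have "cube (Suc m) (pair m (\<lambda>x. c (face_emb (Suc i) b x)) (\<lambda>x. d (face_emb (Suc i) b x)))"
      proof (rule less.IH)
        show "cube m (\<lambda>x. c (face_emb (Suc i) b x))"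
          using less.prems(1) i unfolding n by (rule cube_face)
      qed (use n i less.prems(2) in \<open>simp_all add: length_face_emb\<close>)
      moreover have "?f (face_emb (Suc i) b x)
          = pair m (\<lambda>x. c (face_emb (Suc i) b x)) (\<lambda>x. d (face_emb (Suc i) b x)) x"
        if "length x = n" for x
        using that i n by (simp add: pair_face)
      ultimately show ?thesis unfolding n by (rule iffD2[OF cube_cong, rotated])
    qed
    have "cube n (\<lambda>x. ?f (face_emb (Suc n) False x)) = cube n c"
      by (rule cube_cong) (simp add: pair_face_last)
    then have "cube (Suc n - 1) (\<lambda>x. ?f (face_emb (Suc i) False x))" if "i < Suc n" for i
      using less.prems(1) pair_low[of i False] that n by (cases "i = n") auto
    then have "\<exists>g. cube (Suc n) g \<and> (\<forall>v. length v = Suc n \<and> v \<noteq> all_ones (Suc n) \<longrightarrow> g v = ?f v)"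
      by (rule corner_completion[of "Suc n" ?f])
    then obtain g where g: "cube (Suc n) g"
      "\<And>v. length v = Suc n \<Longrightarrow> v \<noteq> all_ones (Suc n) \<Longrightarrow> g v = ?f v"
      by blast
    have ones: "face_emb (Suc 0) True v = all_ones (Suc n) \<longleftrightarrow> v = all_ones n" for v
      by (simp add: face_emb_def all_ones_def)
    \<comment> \<open>The completion g can differ from the pair only at the vertex of ones. Both
      restrict to n-cubes on the upper face in the first direction, and n > k forces agreement
      there.\<close>
    have "g (face_emb (Suc 0) True (all_ones n)) = ?f (face_emb (Suc 0) True (all_ones n))"
    proof (rule cube_unique)
      show "cube n (\<lambda>x. g (face_emb (Suc 0) True x))"
        using g(1) by (rule cube_face) simp
      show "cube n (\<lambda>x. ?f (face_emb (Suc 0) True x))"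
        by (rule pair_low) simp
    qed (use False g(2) ones in \<open>simp_all add: length_face_emb\<close>)
    then have "g (all_ones (Suc n)) = ?f (all_ones (Suc n))" using ones by metis
    then have "g v = ?f v" if "length v = Suc n" for v
      using g(2)[OF that] by metis
    then show ?thesis using g(1) by (rule iffD1[OF cube_cong])
  qed
qed

section \<open>Fibers and their isomorphism\<close>

definition fiber :: "'a \<Rightarrow> 'a set" where
  "fiber p = {x. cube k (spike k p x)}"

text \<open>Two cubes witnessing the relation are turned into a spike by \<open>cube_spike\<close>;
  conversely, a spike is compared with the constant cube at p.\<close>

lemma sim_rel_Image:
  assumes p: "p \<in> points X"
  shows "sim_rel X (k - 1) `` {p} = fiber p"
proof -
  have k1: "k - 1 + 1 = k" using k_pos by simp
  show ?thesis
  proof (intro subset_antisym subsetI)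
    fix x assume "x \<in> sim_rel X (k - 1) `` {p}"
    then obtain c1 c2 where c: "c1 \<in> cubes X k" "c2 \<in> cubes X k" "c1 (all_ones k) = p"
      "c2 (all_ones k) = x" "\<forall>v\<in>vertices_star k. c1 v = c2 v"
      unfolding sim_rel_def k1 by auto
    have "cube k (spike k (c1 (all_ones k)) (c2 (all_ones k)))"
      using c(5) by (intro cube_spike cube_cubes c(1,2)) (simp add: vertices_star_def vertices_def)
    then show "x \<in> fiber p" using c(3,4) by (simp add: fiber_def)
  next
    fix x assume x: "x \<in> fiber p"
    let ?c1 = "restrict (\<lambda>_. p) (vertices k)" and ?c2 = "restrict (spike k p x) (vertices k)"
    have "?c1 \<in> cubes X k" "?c2 \<in> cubes X k"
      using cube_const[OF p k_pos] x by (simp_all add: cube_def fiber_def)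
    moreover have "?c1 (all_ones k) = p" "?c2 (all_ones k) = x"
      by (simp_all add: vertices_def all_ones_def spike_def)
    moreover have "\<forall>v\<in>vertices_star k. ?c1 v = ?c2 v"
      by (simp add: vertices_star_def spike_def)
    moreover have "x \<in> points X"
      using cube_points[of k "spike k p x" "all_ones k"] x by (simp add: fiber_def spike_def all_ones_def)
    ultimately show "x \<in> sim_rel X (k - 1) `` {p}"
      using p unfolding sim_rel_def k1 by blast
  qed
qed

text \<open>The relation \<open>prism p q\<close> is single-valued and total on the fiber of p, and
  \<open>prism_sym\<close> gives the same backwards, hence a bijection. A cube is transported to the
  opposite face of the pair it spans with its image, in either direction.\<close>

lemma fibers_isomorphic:
  assumes p: "p \<in> points X" and q: "q \<in> points X"
  shows "cube_isomorphic (sub_structure X (fiber p)) (sub_structure X (fiber q))"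
proof -
  define m where "m x = (THE y. prism p q x y)" for x
  have m_eq: "m x = y" if "prism p q x y" for x y
    unfolding m_def using that prism_unique by blast
  have m: "prism p q x (m x)" if "x \<in> fiber p" for x
    using that m_eq prism_exists[OF _ q] unfolding fiber_def by (metis mem_Collect_eq)
  have bij: "bij_betw m (fiber p) (fiber q)"
  proof (rule bij_betwI')
    fix x y assume "x \<in> fiber p" "y \<in> fiber p"
    then show "m x = m y \<longleftrightarrow> x = y"
      using prism_unique prism_sym m by metis
  next
    fix x assume "x \<in> fiber p"
    then show "m x \<in> fiber q" using prism_right[OF m] by (simp add: fiber_def)
  next
    fix y assume "y \<in> fiber q"
    then obtain x where "prism q p y x" using prism_exists[OF _ p] by (auto simp: fiber_def)
    then have "prism p q x y" by (rule prism_sym)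
    then show "\<exists>x\<in>fiber p. y = m x"
      using m_eq prism_left by (metis fiber_def mem_Collect_eq)
  qed
  have "c \<in> cubes (sub_structure X (fiber p)) n \<longleftrightarrow>
      compose (vertices n) m c \<in> cubes (sub_structure X (fiber q)) n"
    if c: "c \<in> vertices n \<rightarrow>\<^sub>E fiber p" for n c
  proof -
    have cF: "\<forall>v\<in>vertices n. c v \<in> fiber p"
      using PiE_mem[OF c] by blast
    then have mF: "\<forall>v\<in>vertices n. m (c v) \<in> fiber q"
      using bij_betwE[OF bij] by blast
    have cm: "prism p q (c v) (m (c v))" if "length v = n" for v
      using that m cF by (simp add: vertices_def)
    have "c \<in> cubes (sub_structure X (fiber p)) n \<longleftrightarrow> cube n c"
      using cF by (simp add: sub_structure_def cube_def PiE_restrict[OF c])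
    also have "\<dots> \<longleftrightarrow> cube n (\<lambda>v. m (c v))"
    proof
      assume "cube n c"
      then have "cube (Suc n) (pair n c (\<lambda>v. m (c v)))"
        using cm by (rule prism_pair_cube)
      then show "cube n (\<lambda>v. m (c v))" by (rule cube_pair_right)
    next
      assume "cube n (\<lambda>v. m (c v))"
      then have "cube (Suc n) (pair n (\<lambda>v. m (c v)) c)"
        using prism_sym[OF cm] by (rule prism_pair_cube)
      then show "cube n c" by (rule cube_pair_right)
    qed
    also have "\<dots> \<longleftrightarrow> compose (vertices n) m c \<in> cubes (sub_structure X (fiber q)) n"
      using mF by (simp add: sub_structure_def cube_def compose_def)
    finally show ?thesis .
  qed
  then show ?thesis
    using bij unfolding cube_isomorphic_def by (auto simp: sub_structure_def)
qed

end

theorem theorem15p4: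
  fixes X :: "'a cube_structure" and k :: nat
  assumes "k \<ge> 2" and "step_groupspace k X"
  shows "\<forall>F\<in>fibers k X. \<forall>F'\<in>fibers k X. cube_isomorphic F F'"
proof -
  interpret step_groupspace_loc X k
    by unfold_locales (use assms in \<open>auto simp: step_groupspace_def\<close>)
  have "\<exists>p\<in>points X. F = sub_structure X (fiber p)" if "F \<in> fibers k X" for F
    using that sim_rel_Image by (auto simp: fibers_def quotient_def)
  then show ?thesis using fibers_isomorphic by blast
qed

end
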